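(* Let $N\ge2$, $e=\binom N2$, let $B\in\mathbb{R}^{N\times e}$ be the incidence matrix of the oriented complete graph on $N$ vertices, let $\tilde K\in\mathbb{R}^e$ be a vector of coupling gains with nonnegative entries such that the network graph is connected, and let $K=\frac1N\operatorname{diag}(\tilde K)$. Consider the system $$\dot X=V,\qquad\dot V=G(X)V,\qquad G(X)=-B^\top BK\operatorname{diag}(\cos X),$$ with $X,V\in\operatorname{Col}(B^\top)\subset\mathbb{R}^e$. Let $\mathcal{E}_s=\{(X,0): X\in(-\frac\pi2,\frac\pi2)^e\cap\operatorname{Col}(B^\top)\}$, and let $\mathcal{H}$ be the set of all $(X,V)\in\mathbb{R}^e\times\mathbb{R}^e$ such that $X=(x_1,\ldots,x_e)\in(-\frac\pi2,\frac\pi2)^e\cap\operatorname{Col}(B^\top)$ and $V=B^\top\omega-B^\top BK\sin(X)$ for some $\omega\in\mathbb{R}^N$ satisfying, for every $i=1,\ldots,e$, $$|e_i^\top B^\top\omega|\le\frac2N\tilde K_i+\frac1N\sum_{j=1,\,j\ne i}^{e}|(B^\top B)_{ij}|\,\tilde K_j\sin|x_j|.$$ Then every equilibrium in $\mathcal{E}_s$ is semistable relative to $\mathcal{H}$.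
   Context: The system describes phase differences $X=B^\top\theta$ and frequency differences $V=B^\top\dot\theta$ in the Kuramoto network $\dot\theta=\omega-BK\sin(B^\top\theta)$ of $N$ oscillators; $V=0$ corresponds to synchronization. The $e$ edges of the complete graph are the pairs $(i,j)$ with $1\le i<j\le N$, listed lexicographically; the column of $B$ for the edge $(i,j)$ has $+1$ in row $i$, $-1$ in row $j$ and $0$ elsewhere. $\tilde K=[K_{12},K_{13},\ldots,K_{(N-1)N}]^\top$ lists the symmetric coupling gains $K_{ij}=K_{ji}$ in the same order. The network graph has vertices $1,\ldots,N$ and an edge between $i$ and $j$ exactly when $K_{ij}>0$. $\operatorname{Col}(B^\top)$ is the column space of $B^\top$; $e_i$ is the $i$th canonical basis vector of $\mathbb{R}^e$; $\sin$ and $\cos$ of a vector are componentwise. Let $\psi(t,z)$ be the solution at time $t$ starting from $z$. An equilibrium $y\in\mathcal{H}$ is Lyapunov stable relative to $\mathcal{H}$ if for every open set $U\ni y$ there is an open set $U'\ni y$ such that $\psi(t,z)\in U$ for all $z\in U'\cap\mathcal{H}$ and $t\ge0$. An equilibrium $x\in\mathcal{H}$ is semistable relative to $\mathcal{H}$ if there is a relatively open neighbourhood $\mathcal{U}\subseteq\mathcal{H}$ of $x$ such that for every $z\in\mathcal{U}$ the limit $\lim_{t\to\infty}\psi(t,z)$ exists and is a Lyapunov stable equilibrium relative to $\mathcal{H}$. *)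

theory Defs
  imports "HOL-Analysis.Analysis"
begin

subsection \<open>Autonomous systems and semistability\<close>

text \<open>A system \<open>z' = F z\<close> on a state space \<open>S\<close>, on the time interval \<open>[0, \<infinity>)\<close>.\<close>

definition solution_on ::
    "('a::real_normed_vector \<Rightarrow> 'a) \<Rightarrow> 'a set \<Rightarrow> (real \<Rightarrow> 'a) \<Rightarrow> bool" where
  "solution_on F S \<phi> \<longleftrightarrow>
     (\<forall>t\<ge>0. \<phi> t \<in> S \<and> (\<phi> has_vector_derivative F (\<phi> t)) (at t within {0..}))"

text \<open>The description is over the value at time \<open>t\<close>, not over \<open>\<phi>\<close>, because a solution is
  unconstrained at negative times. It denotes only if a forward solution from \<open>z\<close> exists and
  all of them agree at time \<open>t\<close>.\<close>

definition flow ::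
    "('a::real_normed_vector \<Rightarrow> 'a) \<Rightarrow> 'a set \<Rightarrow> real \<Rightarrow> 'a \<Rightarrow> 'a" where
  "flow F S t z = (THE w. \<exists>\<phi>. solution_on F S \<phi> \<and> \<phi> 0 = z \<and> \<phi> t = w)"

definition equilibrium ::
    "('a::real_normed_vector \<Rightarrow> 'a) \<Rightarrow> 'a set \<Rightarrow> 'a \<Rightarrow> bool" where
  "equilibrium F S y \<longleftrightarrow> y \<in> S \<and> F y = 0"

definition lyapunov_stable_equilibrium ::
    "('a::real_normed_vector \<Rightarrow> 'a) \<Rightarrow> 'a set \<Rightarrow> 'a set \<Rightarrow> 'a \<Rightarrow> bool" where
  "lyapunov_stable_equilibrium F S H y \<longleftrightarrow>
     equilibrium F S y \<and> y \<in> H \<and>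
     (\<forall>U. open U \<and> y \<in> U \<longrightarrow>
        (\<exists>U'. open U' \<and> y \<in> U' \<and> (\<forall>z \<in> U' \<inter> H. \<forall>t\<ge>0. flow F S t z \<in> U)))"

definition semistable_equilibrium ::
    "('a::real_normed_vector \<Rightarrow> 'a) \<Rightarrow> 'a set \<Rightarrow> 'a set \<Rightarrow> 'a \<Rightarrow> bool" where
  "semistable_equilibrium F S H x \<longleftrightarrow>
     equilibrium F S x \<and> x \<in> H \<and>
     (\<exists>U. openin (top_of_set H) U \<and> x \<in> U \<and>
        (\<forall>z\<in>U. \<exists>l. ((\<lambda>t. flow F S t z) \<longlongrightarrow> l) at_top \<and>
                   lyapunov_stable_equilibrium F S H l))"

subsection \<open>The Kuramoto network on the complete graph\<close>

text \<open>The vertices \<open>1, \<dots>, N\<close> are the elements of a finite linearly ordered type \<open>'n\<close>, and the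
  coordinates of \<open>\<real>\<^sup>e\<close> those of a finite linearly ordered type \<open>'e\<close>. The lexicographic listing
  \<open>ep\<close> of the pairs \<open>i < j\<close> is then unique, and its existence forces
  \<open>CARD('e) = CARD('n) choose 2\<close>.\<close>

definition lex_edge_listing ::
    "('e::{finite,linorder} \<Rightarrow> 'n::{finite,linorder} \<times> 'n) \<Rightarrow> bool" where
  "lex_edge_listing ep \<longleftrightarrow>
     bij_betw ep UNIV {(i, j). i < j} \<and>
     (\<forall>k l. k < l \<longrightarrow>
        fst (ep k) < fst (ep l) \<or> fst (ep k) = fst (ep l) \<and> snd (ep k) < snd (ep l))"

definition incidence_matrix :: "('e::finite \<Rightarrow> 'n::finite \<times> 'n) \<Rightarrow> real^'e^'n" where
  "incidence_matrix ep =
     (\<chi> i k. if i = fst (ep k) then 1 else if i = snd (ep k) then -1 else 0)"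

definition col_space :: "real^'m^'k \<Rightarrow> (real^'k) set" where
  "col_space A = span (columns A)"

definition diag_matrix :: "real^'e \<Rightarrow> real^'e^'e" where
  "diag_matrix v = (\<chi> i j. if i = j then v $ i else 0)"

definition sin_vec :: "real^'e \<Rightarrow> real^'e" where
  "sin_vec X = (\<chi> i. sin (X $ i))"

definition cos_vec :: "real^'e \<Rightarrow> real^'e" where
  "cos_vec X = (\<chi> i. cos (X $ i))"

definition network_graph :: "('e::finite \<Rightarrow> 'n::finite \<times> 'n) \<Rightarrow> real^'e \<Rightarrow> ('n \<times> 'n) set" where
  "network_graph ep Kt = {(i, j). \<exists>k. (ep k = (i, j) \<or> ep k = (j, i)) \<and> Kt $ k > 0}"

definition network_connected :: "('e::finite \<Rightarrow> 'n::finite \<times> 'n) \<Rightarrow> real^'e \<Rightarrow> bool" where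
  "network_connected ep Kt \<longleftrightarrow> (\<forall>i j. (i, j) \<in> (network_graph ep Kt)\<^sup>*)"

definition gain_matrix :: "('e::finite \<Rightarrow> 'n::finite \<times> 'n) \<Rightarrow> real^'e \<Rightarrow> real^'e^'e" where
  "gain_matrix ep Kt = (1 / real CARD('n)) *\<^sub>R diag_matrix Kt"

definition kuramoto_G ::
    "('e::finite \<Rightarrow> 'n::finite \<times> 'n) \<Rightarrow> real^'e \<Rightarrow> real^'e \<Rightarrow> real^'e^'e" where
  "kuramoto_G ep Kt X =
     - (transpose (incidence_matrix ep) ** incidence_matrix ep ** gain_matrix ep Kt
          ** diag_matrix (cos_vec X))"

definition kuramoto_field ::
    "('e::finite \<Rightarrow> 'n::finite \<times> 'n) \<Rightarrow> real^'e \<Rightarrow>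
     (real^'e) \<times> (real^'e) \<Rightarrow> (real^'e) \<times> (real^'e)" where
  "kuramoto_field ep Kt = (\<lambda>(X, V). (V, kuramoto_G ep Kt X *v V))"

definition kuramoto_states ::
    "('e::finite \<Rightarrow> 'n::finite \<times> 'n) \<Rightarrow> ((real^'e) \<times> (real^'e)) set" where
  "kuramoto_states ep =
     col_space (transpose (incidence_matrix ep)) \<times> col_space (transpose (incidence_matrix ep))"

definition phase_box :: "(real^'e) set" where
  "phase_box = {X. \<forall>i. - (pi / 2) < X $ i \<and> X $ i < pi / 2}"

definition sync_equilibria ::
    "('e::finite \<Rightarrow> 'n::finite \<times> 'n) \<Rightarrow> ((real^'e) \<times> (real^'e)) set" where
  "sync_equilibria ep =
     {(X, 0) | X. X \<in> phase_box \<inter> col_space (transpose (incidence_matrix ep))}"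

definition kuramoto_H ::
    "('e::finite \<Rightarrow> 'n::finite \<times> 'n) \<Rightarrow> real^'e \<Rightarrow> ((real^'e) \<times> (real^'e)) set" where
  "kuramoto_H ep Kt =
     {(X, V). X \<in> phase_box \<inter> col_space (transpose (incidence_matrix ep)) \<and>
        (\<exists>\<omega> :: real^'n.
           V = transpose (incidence_matrix ep) *v \<omega>
               - (transpose (incidence_matrix ep) ** incidence_matrix ep ** gain_matrix ep Kt)
                   *v sin_vec X \<and>
           (\<forall>i. \<bar>axis i 1 \<bullet> (transpose (incidence_matrix ep) *v \<omega>)\<bar>
                \<le> 2 / real CARD('n) * Kt $ i
                  + 1 / real CARD('n) *
                      (\<Sum>j\<in>UNIV - {i}.
                         \<bar>(transpose (incidence_matrix ep) ** incidence_matrix ep) $ i $ j\<bar>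
                         * Kt $ j * sin \<bar>X $ j\<bar>)))}"

end

theory Submission imports Defs begin

text \<open>
  On the column space of \<open>B\<^sup>T\<close> one has \<open>B\<^sup>T B = N\<close>, so \<open>|V|\<^sup>2 / 2\<close> decreases along the flow at the
  rate \<open>\<Sum>\<^sub>k K\<^sub>k cos(x\<^sub>k) v\<^sub>k\<^sup>2\<close>, which by connectedness dominates \<open>\<mu> |V|\<^sup>2\<close> uniformly for \<open>X\<close> in a
  compact ball inside the phase box. As long as \<open>X\<close> stays in that ball, \<open>V\<close> decays like \<open>exp (- \<mu> t)\<close>
  and \<open>X\<close> moves by at most \<open>|V(0)| / \<mu>\<close>; so a start with \<open>|X(0) - X\<^sub>0| + |V(0)| / \<mu>\<close> small is
  trapped forever and converges to some \<open>(X, 0)\<close> with \<open>X\<close> in the phase box. The same trapping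
  estimate, applied at the limit, is its Lyapunov stability.
\<close>

subsection \<open>Forward solutions of globally Lipschitz equations and differential inequalities\<close>

text \<open>Integrating an exponential bound gains the factor \<open>1 / a\<close>. With
  \<open>a = 2 * M\<close> this gain beats the Lipschitz constant \<open>M\<close> and yields the
  contraction factor 1/2 in the Picard iteration below.\<close>

lemma norm_integral_exp_le:
  fixes g :: "real \<Rightarrow> 'a::euclidean_space"
  assumes "continuous_on {0..t} g" "0 \<le> t" "0 < a" "0 \<le> C"
    and "\<And>s. 0 \<le> s \<Longrightarrow> s \<le> t \<Longrightarrow> norm (g s) \<le> C * exp (a * s)"
  shows "norm (integral {0..t} g) \<le> C / a * exp (a * t)"
proof -
  have *: "((\<lambda>s. C * exp (a * s)) has_integral (C / a * exp (a * t) - C / a * exp (a * 0))) {0..t}"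
    by (rule fundamental_theorem_of_calculus)
      (use assms in \<open>auto intro!: derivative_eq_intros
        simp: has_real_derivative_iff_has_vector_derivative[symmetric]\<close>)
  have "norm (integral {0..t} g) \<le> integral {0..t} (\<lambda>s. C * exp (a * s))"
    using assms by (intro integral_norm_bound_integral integrable_continuous_real continuous_intros) auto
  also have "\<dots> = C / a * exp (a * t) - C / a" using integral_unique[OF *] by simp
  also have "\<dots> \<le> C / a * exp (a * t)" using assms by simp
  finally show ?thesis .
qed

text \<open>Banach's fixed point theorem for the rescaled unknown \<open>u = \<phi> / E\<close> in
  the complete space of bounded continuous functions; no gluing of local solutions is
  involved.\<close>

lemma lipschitz_imp_global_forward_solution:
  fixes f :: "'a::euclidean_space \<Rightarrow> 'a"
  assumes lip: "L-lipschitz_on UNIV f"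
  shows "\<exists>\<phi>. \<phi> 0 = x \<and> (\<forall>t\<ge>0. (\<phi> has_vector_derivative f (\<phi> t)) (at t within {0..}))"
proof -
  \<comment> \<open>\<open>L\<close> may be 0; adding 1 makes the divisions by \<open>2 * M\<close>
    meaningful.\<close>
  define M where "M = L + 1"
  have M: "M > 0" using lipschitz_on_nonneg[OF lip] by (simp add: M_def)
  have fd: "norm (f u - f v) \<le> M * norm (u - v)" for u v
    using lipschitz_onD[OF lip, of u v] by (simp add: M_def dist_norm algebra_simps)
      (smt (verit) norm_ge_zero)
  have fc[continuous_intros]: "continuous_on S (\<lambda>s. f (h s))" if "continuous_on S h" for S and h :: "real \<Rightarrow> 'a"
    using continuous_on_compose2[OF lipschitz_on_continuous_on[OF lip] that] by simp
  \<comment> \<open>The weight \<open>1 / E\<close> makes the Picard operator a contraction on all of \<open>[0, \<infinity>)\<close> at once.\<close>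
  define E where "E t = exp (2 * M * t)" for t
  define I where "I u t = x + integral {0..t} (\<lambda>s. f (E s *\<^sub>R apply_bcontfun u s))"
    for u :: "real \<Rightarrow>\<^sub>C 'a" and t
  \<comment> \<open>Bounded continuous functions live on the whole line, so at negative times the
    value at 0 is repeated.\<close>
  define T where "T u t = (1 / E (max 0 t)) *\<^sub>R I u (max 0 t)" for u t
  have Epos: "E t > 0" for t by (simp add: E_def)
  have Eone: "t \<ge> 0 \<Longrightarrow> E t \<ge> 1" for t using M by (simp add: E_def)
  have Ec[continuous_intros]: "continuous_on S (\<lambda>s. E (h s))" if "continuous_on S h" for S and h :: "real \<Rightarrow> real"
    unfolding E_def by (intro continuous_intros that)
  have gc: "continuous_on S (\<lambda>s. f (E s *\<^sub>R apply_bcontfun u s))" for S u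
    by (intro continuous_intros continuous_on_apply_bcontfun)
  have Ider: "(I u has_vector_derivative f (E t *\<^sub>R apply_bcontfun u t)) (at t within {0..})" if "0 \<le> t" for u t
  proof -
    \<comment> \<open>The fundamental theorem of calculus is applied on a compact interval; ending
      it at \<open>t + 1\<close> makes it agree with the half-line near \<open>t\<close>.\<close>
    have "(I u has_vector_derivative f (E t *\<^sub>R apply_bcontfun u t)) (at t within {0..t+1})"
      unfolding I_def using that
      by (auto intro!: derivative_eq_intros integral_has_vector_derivative gc)
    moreover have "at t within {0..t+1} = at t within {0..}"
      by (rule at_within_nhd[of t "{..<t+1}"]) (use that in auto)
    ultimately show ?thesis by simp
  qed
  have Ic: "continuous_on {0..} (I u)" for u
    using Ider by (auto simp: continuous_on_eq_continuous_within intro!: has_vector_derivative_continuous)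
  have Tc: "continuous_on UNIV (T u)" for u
    unfolding T_def
    by (intro continuous_intros continuous_on_compose2[OF Ic]) (auto simp: Epos less_imp_neq[symmetric])
  \<comment> \<open>Since 1 \<le> \<open>E\<close>, the weight also absorbs the contributions of
    \<open>x\<close> and \<open>f 0\<close>, so the operator preserves boundedness.\<close>
  have Tb: "norm (T u t) \<le> norm x + (norm (f 0) + M * norm u) / (2 * M)" for u t
  proof -
    define s where "s = max 0 t"
    have s: "s \<ge> 0" by (simp add: s_def)
    have "norm (f (E r *\<^sub>R apply_bcontfun u r)) \<le> (norm (f 0) + M * norm u) * exp (2 * M * r)" if "0 \<le> r" for r
    proof -
      have "norm (f (E r *\<^sub>R apply_bcontfun u r)) \<le> norm (f 0) + norm (f (E r *\<^sub>R apply_bcontfun u r) - f 0)"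
        using norm_triangle_sub by blast
      also have "\<dots> \<le> norm (f 0) + M * (E r * norm (apply_bcontfun u r))"
        using fd[of "E r *\<^sub>R apply_bcontfun u r" 0] Epos[of r] by simp
      also have "\<dots> \<le> norm (f 0) * E r + M * (E r * norm u)"
        using M Epos[of r] Eone[OF that] norm_bounded[of u r]
        by (intro add_mono mult_left_mono) (auto simp: mult_le_cancel_left1 less_imp_le)
      finally show ?thesis by (simp add: E_def algebra_simps)
    qed
    then have "norm (integral {0..s} (\<lambda>s. f (E s *\<^sub>R apply_bcontfun u s)))
        \<le> (norm (f 0) + M * norm u) / (2 * M) * E s"
      unfolding E_def using M s gc[unfolded E_def] by (intro norm_integral_exp_le) auto
    then have "norm (I u s) \<le> norm x * E s + (norm (f 0) + M * norm u) / (2 * M) * E s"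
      unfolding I_def using Eone[OF s]
      by (intro norm_triangle_le add_mono) (auto simp: mult_le_cancel_left1)
    then show ?thesis
      using Epos[of s] by (simp add: T_def s_def[symmetric] pos_divide_le_eq distrib_right)
  qed
  have Tbc: "apply_bcontfun (Bcontfun (T u)) = T u" for u
    by (rule Bcontfun_inverse[OF bcontfun_normI[OF Tc Tb]])
  have "dist (Bcontfun (T u)) (Bcontfun (T v)) \<le> 1/2 * dist u v" for u v
  proof (rule dist_bound)
    fix t :: real
    define s where "s = max 0 t"
    have s: "s \<ge> 0" by (simp add: s_def)
    let ?g = "\<lambda>u s. f (E s *\<^sub>R apply_bcontfun u s)"
    have "norm (?g u r - ?g v r) \<le> (M * dist u v) * exp (2 * M * r)" for r
    proof -
      have "norm (?g u r - ?g v r) \<le> M * norm (E r *\<^sub>R (apply_bcontfun u r - apply_bcontfun v r))"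
        using fd[of "E r *\<^sub>R apply_bcontfun u r" "E r *\<^sub>R apply_bcontfun v r"]
        by (simp add: scaleR_diff_right)
      also have "\<dots> = M * E r * dist (apply_bcontfun u r) (apply_bcontfun v r)"
        using Epos[of r] by (simp add: dist_norm)
      also have "\<dots> \<le> M * E r * dist u v"
        using M Epos[of r] by (intro mult_left_mono dist_bounded) (auto simp: less_imp_le)
      finally show ?thesis by (simp add: E_def algebra_simps)
    qed
    then have "norm (integral {0..s} (\<lambda>r. ?g u r - ?g v r)) \<le> (M * dist u v) / (2 * M) * exp (2 * M * s)"
      using M s by (intro norm_integral_exp_le continuous_on_diff gc) auto
    also have "integral {0..s} (\<lambda>r. ?g u r - ?g v r) = I u s - I v s"
      unfolding I_def by (simp add: integral_diff integrable_continuous_real gc)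
    finally have "norm (I u s - I v s) \<le> dist u v / 2 * E s" using M by (simp add: E_def)
    then show "dist (apply_bcontfun (Bcontfun (T u)) t) (apply_bcontfun (Bcontfun (T v)) t) \<le> 1/2 * dist u v"
      using Epos[of s] unfolding Tbc T_def s_def[symmetric] dist_norm scaleR_diff_right[symmetric]
      by (simp add: divide_simps mult.commute)
  qed
  then obtain u where u: "Bcontfun (T u) = u"
    using banach_fix_type[of "1/2" "\<lambda>u. Bcontfun (T u)"] by auto
  \<comment> \<open>Undoing the weight at the fixed point: \<open>E * u\<close> coincides with
    \<open>I u\<close>, so \<open>I u\<close> satisfies its own integral equation.\<close>
  have eq: "E t *\<^sub>R apply_bcontfun u t = I u t" if "t \<ge> 0" for t
    using Tbc[of u] Epos[of t] that by (simp add: u T_def)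
  show ?thesis
  proof (intro exI conjI allI impI)
    show "I u 0 = x" by (simp add: I_def)
    show "(I u has_vector_derivative f (I u t)) (at t within {0..})" if "0 \<le> t" for t
      using Ider[OF that, of u] eq[OF that] by simp
  qed
qed

text \<open>At interior points the one-sided derivative is the ordinary one; at the end points of
  the interval continuity suffices for the mean value argument.\<close>

lemma nonincreasing_if_derivative_nonpos_on_halfline:
  fixes g :: "real \<Rightarrow> real"
  assumes "\<And>t. 0 \<le> t \<Longrightarrow> t \<le> b \<Longrightarrow> (g has_vector_derivative g' t) (at t within {0..})"
    and "\<And>t. 0 \<le> t \<Longrightarrow> t \<le> b \<Longrightarrow> g' t \<le> 0" and "0 \<le> a" "a \<le> b"
  shows "g b \<le> g a"
proof (rule DERIV_nonpos_imp_decreasing_open[OF \<open>a \<le> b\<close>])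
  fix t assume t: "a < t" "t < b"
  then have "at t within {0..} = at t" using assms by (intro at_within_interior) auto
  then show "\<exists>y. DERIV g t :> y \<and> y \<le> 0"
    using assms(1,2)[of t] t assms(3) by (auto simp: has_real_derivative_iff_has_vector_derivative)
next
  show "continuous_on {a..b} g"
    unfolding continuous_on_eq_continuous_within
  proof
    fix t assume "t \<in> {a..b}"
    then have "(g has_vector_derivative g' t) (at t within {a..b})"
      using assms by (intro has_vector_derivative_within_subset[OF assms(1)]) auto
    then show "continuous (at t within {a..b}) g" by (rule has_vector_derivative_continuous)
  qed
qed

text \<open>Gronwall's argument for the squared norm: by hypothesis its product with
  \<open>exp (- 2 * m * t)\<close> has nonpositive derivative. It serves twice, with
  \<open>m = L\<close> for uniqueness and with \<open>m = - \<mu>\<close> for decay.\<close>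

lemma norm_exp_bound_if_inner_derivative_le:
  fixes D :: "real \<Rightarrow> 'a::real_inner"
  assumes "\<And>t. 0 \<le> t \<Longrightarrow> t \<le> b \<Longrightarrow> (D has_vector_derivative D' t) (at t within {0..})"
    and "\<And>t. 0 \<le> t \<Longrightarrow> t \<le> b \<Longrightarrow> D t \<bullet> D' t \<le> m * (norm (D t))\<^sup>2" and "0 \<le> b"
  shows "norm (D b) \<le> exp (m * b) * norm (D 0)"
proof -
  let ?g = "\<lambda>t. (D t \<bullet> D t) * exp (- 2 * m * t)"
  let ?g' = "\<lambda>t. 2 * (D t \<bullet> D' t - m * (D t \<bullet> D t)) * exp (- 2 * m * t)"
  have "?g b \<le> ?g 0"
  proof (rule nonincreasing_if_derivative_nonpos_on_halfline[where g = ?g and g' = ?g'])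
    fix t assume t: "0 \<le> t" "t \<le> b"
    have "(D has_derivative (\<lambda>h. h *\<^sub>R D' t)) (at t within {0..})"
      using assms(1)[OF t] by (simp add: has_vector_derivative_def)
    then show "(?g has_vector_derivative ?g' t) (at t within {0..})"
      unfolding has_vector_derivative_def
      by (auto intro!: derivative_eq_intros simp: algebra_simps inner_commute)
    show "?g' t \<le> 0"
      using assms(2)[OF t] by (simp add: power2_norm_eq_inner mult_le_0_iff)
  qed (use assms in auto)
  then have "(norm (D b))\<^sup>2 * exp (- 2 * m * b) \<le> (norm (D 0))\<^sup>2" by (simp add: power2_norm_eq_inner)
  then have "(norm (D b))\<^sup>2 \<le> (exp (m * b) * norm (D 0))\<^sup>2"
    by (simp add: power_mult_distrib exp_minus divide_simps mult.commute exp_double[symmetric] mult.assoc)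
  then show ?thesis by (rule power2_le_imp_le) simp
qed

subsection \<open>The coupling operator on the column space\<close>

definition edge_diff :: "('e::finite \<Rightarrow> 'n::finite \<times> 'n) \<Rightarrow> real^'n \<Rightarrow> real^'e" where
  "edge_diff ep \<theta> = transpose (incidence_matrix ep) *v \<theta>"

text \<open>Applied to the vector with entries \<open>cos (X $ k) * V $ k\<close> this operator
  gives minus the acceleration; applied to \<open>sin_vec X\<close> it completes \<open>V\<close> to
  a conserved quantity.\<close>

definition coupling :: "('e::finite \<Rightarrow> 'n::finite \<times> 'n) \<Rightarrow> real^'e \<Rightarrow> real^'e \<Rightarrow> real^'e" where
  "coupling ep Kt w =
     (transpose (incidence_matrix ep) ** incidence_matrix ep ** gain_matrix ep Kt) *v w"

lemma col_space_eq_range: "col_space A = range ((*v) A)"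
proof
  have "subspace (range ((*v) A))"
    by (intro linear_subspace_image matrix_vector_mul_linear) (auto simp: subspace_UNIV)
  moreover have "columns A \<subseteq> range ((*v) A)"
    by (auto simp: columns_def) (metis matrix_vector_mult_basis rangeI)
  ultimately show "col_space A \<subseteq> range ((*v) A)"
    unfolding col_space_def by (intro span_minimal)
  show "range ((*v) A) \<subseteq> col_space A"
    by (auto simp: col_space_def matrix_vector_mult_in_columnspace)
qed

lemma col_space_edge_diff:
  "col_space (transpose (incidence_matrix ep)) = range (edge_diff ep)"
  by (simp add: col_space_eq_range edge_diff_def[abs_def] del: transpose_matrix_vector)

lemma subspace_col_space: "subspace (col_space A)"
  by (simp add: col_space_def)

lemma lex_edge_listing_ne:
  assumes "lex_edge_listing ep"
  shows "fst (ep k) \<noteq> snd (ep k)"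
proof -
  have "ep k \<in> {(i, j). i < j}"
    using bij_betwE[of ep UNIV] assms unfolding lex_edge_listing_def by (metis UNIV_I)
  then show ?thesis by auto
qed

lemma edge_diff_nth:
  assumes "lex_edge_listing ep"
  shows "edge_diff ep \<theta> $ k = \<theta> $ fst (ep k) - \<theta> $ snd (ep k)"
proof -
  have ne: "fst (ep k) \<noteq> snd (ep k)" by (rule lex_edge_listing_ne[OF assms])
  have "edge_diff ep \<theta> $ k = (\<Sum>i\<in>UNIV. (if i = fst (ep k) then \<theta> $ i else 0)
      + (if i = snd (ep k) then - \<theta> $ i else 0))"
    unfolding edge_diff_def matrix_vector_mult_def transpose_def incidence_matrix_def
    using ne by (auto intro!: sum.cong)
  then show ?thesis by (simp add: sum.distrib)
qed

text \<open>This is the Laplacian of the complete graph, \<open>N\<close> times the identity minus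
  the all-ones matrix. Only edges at vertex \<open>i\<close> contribute, and reversing an edge
  changes the sign of both the incidence entry and the difference.\<close>

lemma incidence_edge_diff_nth:
  fixes ep :: "'e::{finite,linorder} \<Rightarrow> 'n::{finite,linorder} \<times> 'n"
  assumes "lex_edge_listing ep"
  shows "(incidence_matrix ep *v edge_diff ep \<theta>) $ i
    = real CARD('n) * \<theta> $ i - (\<Sum>j\<in>UNIV. \<theta> $ j)"
proof -
  define g where "g = (\<lambda>(a, b). (if i = a then 1 else if i = b then - 1 else 0) * (\<theta> $ a - \<theta> $ b))"
  \<comment> \<open>Enumerates the edges at \<open>i\<close> by their other end \<open>j\<close>,
    with the smaller vertex first as in the listing.\<close>
  let ?h = "\<lambda>j. (min i j, max i j)"
  have inj: "inj_on ?h (UNIV - {i})"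
    by (auto simp: inj_on_def min_def max_def split: if_splits)
  have bij: "bij_betw ep UNIV {(a, b). a < b}"
    using assms by (simp add: lex_edge_listing_def)
  have "(incidence_matrix ep *v edge_diff ep \<theta>) $ i = (\<Sum>k\<in>UNIV. g (ep k))"
    by (auto simp: matrix_vector_mult_def incidence_matrix_def edge_diff_nth[OF assms] g_def
        case_prod_unfold intro!: sum.cong)
  also have "\<dots> = sum g {(a, b). a < b}"
    by (rule sum.reindex_bij_betw[OF bij])
  also have "\<dots> = sum g (?h ` (UNIV - {i}))"
  proof (rule sum.mono_neutral_right)
    show "\<forall>p\<in>{(a, b). a < b} - ?h ` (UNIV - {i}). g p = 0"
    proof clarify
      fix a b assume "a < b" "(a, b) \<notin> ?h ` (UNIV - {i})"
      then have "i \<noteq> a" "i \<noteq> b"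
        by (auto simp: image_iff dest: bspec[of _ _ b] bspec[of _ _ a])
      then show "g (a, b) = 0" by (simp add: g_def)
    qed
    show "?h ` (UNIV - {i}) \<subseteq> {(a, b). a < b}"
      by (auto simp: min_def max_def)
  qed simp
  also have "\<dots> = (\<Sum>j\<in>UNIV - {i}. \<theta> $ i - \<theta> $ j)"
    unfolding sum.reindex[OF inj] o_def
    by (rule sum.cong) (auto simp: g_def min_def max_def)
  \<comment> \<open>The added term \<open>j = i\<close> is zero.\<close>
  also have "\<dots> = (\<Sum>j\<in>UNIV. \<theta> $ i - \<theta> $ j)"
    by (rule sum.mono_neutral_left) auto
  also have "\<dots> = real CARD('n) * \<theta> $ i - (\<Sum>j\<in>UNIV. \<theta> $ j)"
    by (simp add: sum_subtractf)
  finally show ?thesis .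
qed

text \<open>The sum subtracted by the Laplacian is the same at every vertex and cancels in
  differences, so \<open>N\<close> remains as an eigenvalue on the whole column space.\<close>

lemma edge_diff_incidence_edge_diff:
  fixes ep :: "'e::{finite,linorder} \<Rightarrow> 'n::{finite,linorder} \<times> 'n"
  assumes "lex_edge_listing ep"
  shows "edge_diff ep (incidence_matrix ep *v edge_diff ep \<theta>) = real CARD('n) *\<^sub>R edge_diff ep \<theta>"
  by (simp add: vec_eq_iff edge_diff_nth[OF assms] incidence_edge_diff_nth[OF assms] algebra_simps)

lemma inner_edge_diff: "edge_diff ep \<theta> \<bullet> w = \<theta> \<bullet> (incidence_matrix ep *v w)"
  by (simp add: edge_diff_def dot_lmul_matrix)

lemma gain_matrix_mult:
  fixes ep :: "'e::finite \<Rightarrow> 'n::finite \<times> 'n"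
  shows "gain_matrix ep Kt *v w = (\<chi> k. Kt $ k * w $ k / real CARD('n))"
  by (simp add: vec_eq_iff gain_matrix_def diag_matrix_def matrix_vector_mult_def mult_delta_left
      flip: sum_divide_distrib)

lemma coupling_eq:
  "coupling ep Kt w = edge_diff ep (incidence_matrix ep *v (gain_matrix ep Kt *v w))"
  by (simp add: coupling_def edge_diff_def matrix_vector_mul_assoc matrix_mul_assoc
      del: transpose_matrix_vector)

lemma coupling_in_range: "coupling ep Kt w \<in> range (edge_diff ep)"
  by (simp add: coupling_eq)

lemma bounded_linear_coupling: "bounded_linear (coupling ep Kt)"
  unfolding coupling_def[abs_def] by simp

text \<open>The symmetric operator \<open>B\<^sup>T B\<close> is moved onto \<open>V\<close>, where
  it is multiplication by \<open>N\<close>; this cancels the factor \<open>1 / N\<close> in the gain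
  matrix.\<close>

lemma inner_coupling:
  fixes ep :: "'e::{finite,linorder} \<Rightarrow> 'n::{finite,linorder} \<times> 'n"
  assumes "lex_edge_listing ep" and "V \<in> range (edge_diff ep)"
  shows "V \<bullet> coupling ep Kt w = (\<Sum>k\<in>UNIV. Kt $ k * (V $ k * w $ k))"
proof -
  obtain \<theta> where V: "V = edge_diff ep \<theta>" using assms(2) by auto
  let ?g = "gain_matrix ep Kt *v w"
  have "V \<bullet> coupling ep Kt w = edge_diff ep (incidence_matrix ep *v ?g) \<bullet> V"
    unfolding coupling_eq by (rule inner_commute)
  also have "\<dots> = edge_diff ep (incidence_matrix ep *v V) \<bullet> ?g"
    by (simp only: inner_edge_diff) (rule inner_commute)
  also have "\<dots> = real CARD('n) * (V \<bullet> ?g)"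
    by (simp add: V edge_diff_incidence_edge_diff[OF assms(1)])
  also have "\<dots> = (\<Sum>k\<in>UNIV. Kt $ k * (V $ k * w $ k))"
    by (simp add: gain_matrix_mult inner_vec_def sum_distrib_left) (simp add: algebra_simps)
  finally show ?thesis .
qed

lemma kuramoto_G_mult:
  fixes ep :: "'e::finite \<Rightarrow> 'n::finite \<times> 'n"
  shows "kuramoto_G ep Kt X *v V = - coupling ep Kt (\<chi> k. cos (X $ k) * V $ k)"
proof -
  have "diag_matrix (cos_vec X) *v V = (\<chi> k. cos (X $ k) * V $ k)"
    by (simp add: vec_eq_iff diag_matrix_def cos_vec_def matrix_vector_mult_def mult_delta_left)
  moreover have "(- A) *v x = - (A *v x)" for A :: "real^'e^'e" and x
    by (simp add: vec_eq_iff matrix_vector_mult_def sum_negf)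
  ultimately show ?thesis
    by (simp add: kuramoto_G_def coupling_def flip: matrix_vector_mul_assoc)
qed

text \<open>All summands are nonnegative, hence all vanish. So a potential \<open>\<theta>\<close>
  of \<open>V\<close> takes equal values at the ends of every edge of positive gain, and
  connectedness makes it constant.\<close>

lemma eq_0_if_weighted_sum_squares_eq_0:
  fixes ep :: "'e::{finite,linorder} \<Rightarrow> 'n::{finite,linorder} \<times> 'n"
  assumes "lex_edge_listing ep" "\<forall>k. Kt $ k \<ge> 0" "network_connected ep Kt"
    and V: "V \<in> range (edge_diff ep)"
    and c: "\<And>k. c k > 0" and sum0: "(\<Sum>k\<in>UNIV. Kt $ k * (V $ k * (c k * V $ k))) = 0"
  shows "V = 0"
proof -
  obtain \<theta> where \<theta>: "V = edge_diff ep \<theta>" using V by auto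
  have nonneg: "0 \<le> Kt $ k * (V $ k * (c k * V $ k))" for k
  proof -
    have "Kt $ k * (V $ k * (c k * V $ k)) = Kt $ k * c k * (V $ k)\<^sup>2"
      by (simp add: power2_eq_square)
    then show ?thesis using assms(2) less_imp_le[OF c[of k]] by (simp only:) simp
  qed
  have z: "Kt $ k * (V $ k * (c k * V $ k)) = 0" for k
    using sum0 nonneg sum_nonneg_eq_0_iff[of UNIV "\<lambda>k. Kt $ k * (V $ k * (c k * V $ k))"] by auto
  have Vz: "V $ k = 0" if "Kt $ k > 0" for k
    using z[of k] c[of k] that by auto
  have "\<theta> $ i = \<theta> $ j" if "(i, j) \<in> (network_graph ep Kt)\<^sup>*" for i j
    using that
  proof induction
    case (step j l)
    then obtain k where "ep k = (j, l) \<or> ep k = (l, j)" "Kt $ k > 0"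
      by (auto simp: network_graph_def)
    then have "\<theta> $ j = \<theta> $ l" using Vz[of k] edge_diff_nth[OF assms(1), of \<theta> k] \<theta> by auto
    with step show ?case by simp
  qed simp
  then show ?thesis using assms(3)
    by (auto simp: vec_eq_iff \<theta> edge_diff_nth[OF assms(1)] network_connected_def)
qed

text \<open>A continuous positive function on a compact set has a positive minimum. It is taken over
  unit vectors \<open>V\<close>; homogeneity of degree 2 covers the others.\<close>

lemma coupling_coercive:
  fixes ep :: "'e::{finite,linorder} \<Rightarrow> 'n::{finite,linorder} \<times> 'n"
  assumes "lex_edge_listing ep" "\<forall>k. Kt $ k \<ge> 0" "network_connected ep Kt"
    and C: "compact C" "C \<subseteq> phase_box"
  obtains \<mu> where "\<mu> > 0"
    "\<And>X V. X \<in> C \<Longrightarrow> V \<in> range (edge_diff ep) \<Longrightarrow>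
       V \<bullet> coupling ep Kt (\<chi> k. cos (X $ k) * V $ k) \<ge> \<mu> * (norm V)\<^sup>2"
proof -
  let ?R = "range (edge_diff ep)"
  let ?q = "\<lambda>X V. \<Sum>k\<in>UNIV. Kt $ k * (V $ k * (cos (X $ k) * V $ k))"
  have sub: "subspace ?R"
    using subspace_col_space[of "transpose (incidence_matrix ep)"] by (simp add: col_space_edge_diff)
  have eq: "V \<bullet> coupling ep Kt (\<chi> k. cos (X $ k) * V $ k) = ?q X V" if "V \<in> ?R" for X V
    by (simp add: inner_coupling[OF assms(1) that])
  have cosp: "cos (X $ k) > 0" if "X \<in> C" for X k
    using that C(2) by (auto simp: phase_box_def intro!: cos_gt_zero_pi)
  define D where "D = C \<times> (sphere 0 1 \<inter> ?R)"
  have D: "compact D"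
    unfolding D_def by (intro compact_Times C compact_Int_closed compact_sphere closed_subspace sub)
  have pos: "?q X V > 0" if "(X, V) \<in> D" for X V
  proof -
    have V: "V \<in> ?R" "V \<noteq> 0" and X: "X \<in> C" using that by (auto simp: D_def)
    have "?q X V \<ge> 0"
    proof (rule sum_nonneg)
      fix k
      have "Kt $ k * (V $ k * (cos (X $ k) * V $ k)) = Kt $ k * cos (X $ k) * (V $ k)\<^sup>2"
        by (simp add: power2_eq_square)
      then show "0 \<le> Kt $ k * (V $ k * (cos (X $ k) * V $ k))"
        using assms(2) less_imp_le[OF cosp[OF X, of k]] by (simp only:) simp
    qed
    moreover have "?q X V \<noteq> 0"
      using eq_0_if_weighted_sum_squares_eq_0[OF assms(1-3) V(1), of "\<lambda>k. cos (X $ k)"] cosp[OF X] V(2)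
      by auto
    ultimately show ?thesis by simp
  qed
  obtain \<mu> where \<mu>: "\<mu> > 0" "\<And>X V. (X, V) \<in> D \<Longrightarrow> \<mu> \<le> ?q X V"
  proof (cases "D = {}")
    case False
    have "continuous_on D (\<lambda>p. ?q (fst p) (snd p))" by (intro continuous_intros)
    from continuous_attains_inf[OF D False this]
    obtain p where "p \<in> D" "\<forall>p'\<in>D. ?q (fst p) (snd p) \<le> ?q (fst p') (snd p')" ..
    then show thesis using pos[of "fst p" "snd p"] by (intro that[of "?q (fst p) (snd p)"]) auto
  \<comment> \<open>Over an empty \<open>D\<close> the bound is vacuous, and any positive constant
    serves.\<close>
  qed (use that[of 1] in auto)
  show thesis
  proof
    show "\<mu> > 0" by fact
    fix X V assume X: "X \<in> C" and V: "V \<in> ?R"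
    show "V \<bullet> coupling ep Kt (\<chi> k. cos (X $ k) * V $ k) \<ge> \<mu> * (norm V)\<^sup>2"
    proof (cases "V = 0")
      case False
      let ?W = "(1 / norm V) *\<^sub>R V"
      have "(X, ?W) \<in> D" using X V False subspace_scale[OF sub V] by (auto simp: D_def)
      then have "\<mu> \<le> ?q X ?W" by (rule \<mu>)
      also have "?q X ?W = ?q X V / (norm V)\<^sup>2"
        by (simp add: sum_divide_distrib power2_eq_square)
      finally show ?thesis using False eq[OF V, of X] by (simp add: pos_le_divide_eq)
    qed simp
  qed
qed

subsection \<open>Solutions of the Kuramoto system\<close>

lemma sin_vec_lipschitz: "1-lipschitz_on UNIV (sin_vec :: real^'e \<Rightarrow> real^'e)"
proof (rule lipschitz_onI)
  fix X Y :: "real^'e"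
  have "norm (sin_vec X - sin_vec Y) \<le> norm (X - Y)"
  proof (rule norm_le_componentwise_cart)
    fix i
    have "\<bar>sin (X $ i) - sin (Y $ i)\<bar>
        = 2 * \<bar>sin ((X $ i - Y $ i) / 2)\<bar> * \<bar>cos ((X $ i + Y $ i) / 2)\<bar>"
      by (simp add: sin_diff_sin abs_mult)
    also have "\<dots> \<le> 2 * \<bar>(X $ i - Y $ i) / 2\<bar> * 1"
      by (intro mult_mono abs_sin_x_le_abs_x abs_cos_le_one) auto
    finally show "norm ((sin_vec X - sin_vec Y) $ i) \<le> norm ((X - Y) $ i)"
      by (simp add: sin_vec_def)
  qed
  then show "dist (sin_vec X) (sin_vec Y) \<le> 1 * dist X Y" by (simp add: dist_norm)
qed simp

lemma has_vector_derivative_sin_vec: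
  fixes X :: "real \<Rightarrow> real^'e"
  assumes "(X has_vector_derivative V) (at t within A)"
  shows "((\<lambda>t. sin_vec (X t)) has_vector_derivative (\<chi> k. cos (X t $ k) * V $ k)) (at t within A)"
  unfolding has_vector_derivative_def
proof (subst has_derivative_componentwise_within, rule ballI)
  fix b :: "real^'e" assume "b \<in> Basis"
  then obtain k where b: "b = axis k 1" unfolding Basis_vec_def by auto
  have "((\<lambda>t. X t $ k) has_derivative (\<lambda>h. h *\<^sub>R V $ k)) (at t within A)"
    using bounded_linear.has_derivative[OF bounded_linear_vec_nth[of k] assms[unfolded has_vector_derivative_def]]
    by simp
  then show "((\<lambda>t. sin_vec (X t) \<bullet> b) has_derivative
      (\<lambda>h. (h *\<^sub>R (\<chi> k. cos (X t $ k) * V $ k)) \<bullet> b)) (at t within A)"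
    by (auto simp: b inner_axis sin_vec_def intro!: derivative_eq_intros)
qed

lemma kuramoto_states_eq: "kuramoto_states ep = range (edge_diff ep) \<times> range (edge_diff ep)"
  by (simp add: kuramoto_states_def col_space_edge_diff del: transpose_matrix_vector)

lemma bounded_linear_edge_diff: "bounded_linear (edge_diff ep)"
  unfolding edge_diff_def[abs_def] by (rule matrix_vector_mul_bounded_linear)

lemma subspace_range_edge_diff: "subspace (range (edge_diff ep))"
  using subspace_col_space[of "transpose (incidence_matrix ep)"] by (simp add: col_space_edge_diff)

lemma solution_on_kuramotoD:
  assumes "solution_on (kuramoto_field ep Kt) (kuramoto_states ep) \<phi>" "0 \<le> t"
  shows "fst (\<phi> t) \<in> range (edge_diff ep)" "snd (\<phi> t) \<in> range (edge_diff ep)"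
    and "((\<lambda>t. fst (\<phi> t)) has_vector_derivative snd (\<phi> t)) (at t within {0..})"
    and "((\<lambda>t. snd (\<phi> t)) has_vector_derivative
      - coupling ep Kt (\<chi> k. cos (fst (\<phi> t) $ k) * snd (\<phi> t) $ k)) (at t within {0..})"
proof -
  have 1: "\<phi> t \<in> kuramoto_states ep"
    and 2: "(\<phi> has_vector_derivative kuramoto_field ep Kt (\<phi> t)) (at t within {0..})"
    using assms by (auto simp: solution_on_def)
  show "fst (\<phi> t) \<in> range (edge_diff ep)" "snd (\<phi> t) \<in> range (edge_diff ep)"
    using 1 by (auto simp: kuramoto_states_eq)
  show "((\<lambda>t. fst (\<phi> t)) has_vector_derivative snd (\<phi> t)) (at t within {0..})"
    using bounded_linear.has_vector_derivative[OF bounded_linear_fst 2]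
    by (simp add: kuramoto_field_def case_prod_unfold)
  show "((\<lambda>t. snd (\<phi> t)) has_vector_derivative
      - coupling ep Kt (\<chi> k. cos (fst (\<phi> t) $ k) * snd (\<phi> t) $ k)) (at t within {0..})"
    using bounded_linear.has_vector_derivative[OF bounded_linear_snd 2]
    by (simp add: kuramoto_field_def case_prod_unfold kuramoto_G_mult)
qed

text \<open>The derivative of the sine is the very vector that \<open>coupling\<close> receives in
  the equation for \<open>V\<close>, so the two terms cancel. This reduces the system to a
  first-order equation for \<open>X\<close> with a globally Lipschitz right-hand side, whereas the
  product of cosine and velocity in the field is not globally Lipschitz.\<close>

lemma kuramoto_conserved:
  assumes "solution_on (kuramoto_field ep Kt) (kuramoto_states ep) \<phi>" "0 \<le> t"
  shows "snd (\<phi> t) = snd (\<phi> 0) + coupling ep Kt (sin_vec (fst (\<phi> 0))) - coupling ep Kt (sin_vec (fst (\<phi> t)))"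
proof -
  let ?c = "\<lambda>t. snd (\<phi> t) + coupling ep Kt (sin_vec (fst (\<phi> t)))"
  have "(?c has_vector_derivative 0) (at s within {0..})" if "0 \<le> s" for s
    using has_vector_derivative_add[OF solution_on_kuramotoD(4)[OF assms(1) that]
      bounded_linear.has_vector_derivative[OF bounded_linear_coupling[of ep Kt]
        has_vector_derivative_sin_vec[OF solution_on_kuramotoD(3)[OF assms(1) that]]]]
    by simp
  then obtain c where "\<And>s. s \<in> {0..} \<Longrightarrow> ?c s = c"
    using has_vector_derivative_zero_constant[of "{0..}" ?c] by (auto simp: convex_real_interval)
  from this[of t] this[of 0] show ?thesis using assms(2) by (simp add: algebra_simps)
qed

text \<open>With equal initial data the conserved quantities agree, so the velocities differ by at
  most \<open>L\<close> times the distance of the phases. Gronwall identifies the phases, and the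
  conservation law then identifies the velocities.\<close>

lemma kuramoto_solution_unique:
  assumes \<phi>: "solution_on (kuramoto_field ep Kt) (kuramoto_states ep) \<phi>"
    and \<psi>: "solution_on (kuramoto_field ep Kt) (kuramoto_states ep) \<psi>"
    and init: "\<phi> 0 = \<psi> 0" and t: "0 \<le> t"
  shows "\<phi> t = \<psi> t"
proof -
  obtain L where L: "L-lipschitz_on UNIV (coupling ep Kt)"
    using bounded_linear.lipschitz_boundE[OF bounded_linear_coupling] by metis
  let ?D = "\<lambda>s. fst (\<phi> s) - fst (\<psi> s)"
  have "norm (?D t) \<le> exp (L * t) * norm (?D 0)"
  proof (rule norm_exp_bound_if_inner_derivative_le[OF _ _ t])
    fix s assume s: "0 \<le> s" "s \<le> t"
    show "(?D has_vector_derivative snd (\<phi> s) - snd (\<psi> s)) (at s within {0..})"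
      using s by (intro has_vector_derivative_diff solution_on_kuramotoD(3)[OF \<phi>]
          solution_on_kuramotoD(3)[OF \<psi>])
    have "norm (snd (\<phi> s) - snd (\<psi> s))
        = norm (coupling ep Kt (sin_vec (fst (\<phi> s))) - coupling ep Kt (sin_vec (fst (\<psi> s))))"
      by (simp add: kuramoto_conserved[OF \<phi> s(1)] kuramoto_conserved[OF \<psi> s(1)] init norm_minus_commute)
    also have "\<dots> \<le> L * norm (sin_vec (fst (\<phi> s)) - sin_vec (fst (\<psi> s)))"
      using lipschitz_onD[OF L] by (auto simp: dist_norm)
    also have "\<dots> \<le> L * norm (?D s)"
      using lipschitz_onD[OF sin_vec_lipschitz, of "fst (\<phi> s)" "fst (\<psi> s)"] lipschitz_on_nonneg[OF L]
      by (intro mult_left_mono) (auto simp: dist_norm)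
    finally have "norm (?D s) * norm (snd (\<phi> s) - snd (\<psi> s)) \<le> norm (?D s) * (L * norm (?D s))"
      by (intro mult_left_mono) auto
    then show "?D s \<bullet> (snd (\<phi> s) - snd (\<psi> s)) \<le> L * (norm (?D s))\<^sup>2"
      using norm_cauchy_schwarz[of "?D s" "snd (\<phi> s) - snd (\<psi> s)"]
      by (simp add: power2_eq_square mult.left_commute)
  qed
  then have "fst (\<phi> t) = fst (\<psi> t)" using init by simp
  moreover from this have "snd (\<phi> t) = snd (\<psi> t)"
    by (simp add: kuramoto_conserved[OF \<phi> t] kuramoto_conserved[OF \<psi> t] init)
  ultimately show ?thesis by (simp add: prod_eq_iff)
qed

text \<open>Since \<open>V + B\<^sup>T B K sin X\<close> is conserved, solutions are the images of solutions of the phase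
  equation \<open>\<theta>' = \<omega> - B K sin (B\<^sup>T \<theta>)\<close>, whose right-hand side is globally Lipschitz.\<close>

lemma kuramoto_solution_exists:
  assumes "z \<in> kuramoto_states ep"
  obtains \<phi> where "solution_on (kuramoto_field ep Kt) (kuramoto_states ep) \<phi>" "\<phi> 0 = z"
proof -
  have sub: "subspace (range (edge_diff ep))" by (rule subspace_range_edge_diff)
  from assms obtain \<theta>0 where \<theta>0: "fst z = edge_diff ep \<theta>0"
    and V0: "snd z \<in> range (edge_diff ep)" by (auto simp: kuramoto_states_eq)
  \<comment> \<open>The conserved value lies in the column space, so some frequency vector
    \<open>\<omega>\<close> realizes it.\<close>
  have "snd z + coupling ep Kt (sin_vec (fst z)) \<in> range (edge_diff ep)"
    by (intro subspace_add[OF sub] V0 coupling_in_range)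
  then obtain \<omega> where \<omega>: "snd z + coupling ep Kt (sin_vec (fst z)) = edge_diff ep \<omega>" by auto
  let ?B = "\<lambda>w. incidence_matrix ep *v (gain_matrix ep Kt *v w)"
  let ?f = "\<lambda>\<theta>. \<omega> - ?B (sin_vec (edge_diff ep \<theta>))"
  obtain C where C: "C-lipschitz_on UNIV (edge_diff ep)"
    using bounded_linear.lipschitz_boundE[OF bounded_linear_edge_diff] by metis
  have "bounded_linear ?B"
    by (intro bounded_linear_compose[OF matrix_vector_mul_bounded_linear] matrix_vector_mul_bounded_linear)
  then obtain L where L: "L-lipschitz_on UNIV ?B"
    using bounded_linear.lipschitz_boundE by metis
  \<comment> \<open>The constant is assembled from 0 for \<open>\<omega>\<close>, 1 for the sine,
    and \<open>L\<close> and \<open>C\<close> for the linear maps around it.\<close>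
  have lip: "(0 + L * (1 * C))-lipschitz_on UNIV ?f"
    by (intro lipschitz_on_diff lipschitz_on_constant lipschitz_on_compose2[where g = ?B]
        lipschitz_on_compose2[where g = sin_vec] C lipschitz_on_subset[OF L]
        lipschitz_on_subset[OF sin_vec_lipschitz]) auto
  from lipschitz_imp_global_forward_solution[OF lip, of \<theta>0]
  obtain \<theta> where \<theta>: "\<theta> 0 = \<theta>0"
    "\<And>t. 0 \<le> t \<Longrightarrow> (\<theta> has_vector_derivative ?f (\<theta> t)) (at t within {0..})"
    by blast
  let ?X = "\<lambda>t. edge_diff ep (\<theta> t)"
  \<comment> \<open>The velocity is read off from the conservation law; that it satisfies its own
    equation follows by differentiation.\<close>
  let ?V = "\<lambda>t. edge_diff ep \<omega> - coupling ep Kt (sin_vec (?X t))"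
  show thesis
  proof
    show "(?X 0, ?V 0) = z"
      by (simp add: prod_eq_iff \<theta>(1) flip: \<theta>0 \<omega>)
    show "solution_on (kuramoto_field ep Kt) (kuramoto_states ep) (\<lambda>t. (?X t, ?V t))"
      unfolding solution_on_def
    proof (intro allI impI conjI)
      fix t :: real assume t: "0 \<le> t"
      show "(?X t, ?V t) \<in> kuramoto_states ep"
        unfolding kuramoto_states_eq
        by (intro SigmaI subspace_diff[OF sub] coupling_in_range rangeI)
      have X: "(?X has_vector_derivative ?V t) (at t within {0..})"
        using bounded_linear.has_vector_derivative[OF bounded_linear_edge_diff \<theta>(2)[OF t]]
        by (simp add: linear_diff[OF bounded_linear.linear[OF bounded_linear_edge_diff]] coupling_eq)
      have "(?V has_vector_derivative 0 - coupling ep Kt (\<chi> k. cos (?X t $ k) * ?V t $ k)) (at t within {0..})"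
        by (intro has_vector_derivative_diff has_vector_derivative_const
            bounded_linear.has_vector_derivative[OF bounded_linear_coupling]
            has_vector_derivative_sin_vec X)
      then show "((\<lambda>t. (?X t, ?V t)) has_vector_derivative kuramoto_field ep Kt (?X t, ?V t)) (at t within {0..})"
        using has_vector_derivative_Pair[OF X] by (simp add: kuramoto_field_def kuramoto_G_mult)
    qed
  qed
qed

text \<open>Uniqueness makes the definite description in \<open>flow\<close> denote, so the flow can
  be studied through any one solution.\<close>

lemma flow_kuramoto_eq:
  assumes "solution_on (kuramoto_field ep Kt) (kuramoto_states ep) \<phi>" "0 \<le> t"
  shows "flow (kuramoto_field ep Kt) (kuramoto_states ep) t (\<phi> 0) = \<phi> t"
  unfolding flow_def
proof (rule the_equality)
  fix w assume "\<exists>\<psi>. solution_on (kuramoto_field ep Kt) (kuramoto_states ep) \<psi> \<and> \<psi> 0 = \<phi> 0 \<and> \<psi> t = w"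
  then obtain \<psi> where "solution_on (kuramoto_field ep Kt) (kuramoto_states ep) \<psi>" "\<psi> 0 = \<phi> 0" "\<psi> t = w"
    by blast
  then show "w = \<phi> t" using kuramoto_solution_unique[of ep Kt \<psi> \<phi> t] assms by simp
qed (use assms in \<open>intro exI[of _ \<phi>], simp\<close>)

section \<open>Decay of the velocity and convergence of the phase\<close>

lemma kuramoto_velocity_decay:
  assumes \<phi>: "solution_on (kuramoto_field ep Kt) (kuramoto_states ep) \<phi>"
    and coercive: "\<And>X V. X \<in> C \<Longrightarrow> V \<in> range (edge_diff ep) \<Longrightarrow>
       V \<bullet> coupling ep Kt (\<chi> k. cos (X $ k) * V $ k) \<ge> \<mu> * (norm V)\<^sup>2"
    and stay: "\<And>s. 0 \<le> s \<Longrightarrow> s \<le> t \<Longrightarrow> fst (\<phi> s) \<in> C" and t: "0 \<le> t"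
  shows "norm (snd (\<phi> t)) \<le> exp (- \<mu> * t) * norm (snd (\<phi> 0))"
proof (rule norm_exp_bound_if_inner_derivative_le[OF _ _ t])
  fix s assume s: "0 \<le> s" "s \<le> t"
  show "((\<lambda>t. snd (\<phi> t)) has_vector_derivative
      - coupling ep Kt (\<chi> k. cos (fst (\<phi> s) $ k) * snd (\<phi> s) $ k)) (at s within {0..})"
    by (rule solution_on_kuramotoD(4)[OF \<phi> s(1)])
  show "snd (\<phi> s) \<bullet> - coupling ep Kt (\<chi> k. cos (fst (\<phi> s) $ k) * snd (\<phi> s) $ k)
      \<le> - \<mu> * (norm (snd (\<phi> s)))\<^sup>2"
    using coercive[OF stay[OF s] solution_on_kuramotoD(2)[OF \<phi> s(1)]] by simp
qed

text \<open>The velocity decay is integrated from \<open>s\<close> to \<open>t\<close>. The phase is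
  required to be in \<open>C\<close> only before \<open>t\<close>, so that the bound applies at a
  time of first exit.\<close>

lemma kuramoto_displacement_bound:
  assumes \<phi>: "solution_on (kuramoto_field ep Kt) (kuramoto_states ep) \<phi>"
    and \<mu>: "\<mu> > 0"
    and coercive: "\<And>X V. X \<in> C \<Longrightarrow> V \<in> range (edge_diff ep) \<Longrightarrow>
       V \<bullet> coupling ep Kt (\<chi> k. cos (X $ k) * V $ k) \<ge> \<mu> * (norm V)\<^sup>2"
    and stay: "\<And>s. 0 \<le> s \<Longrightarrow> s < t \<Longrightarrow> fst (\<phi> s) \<in> C" and s: "0 \<le> s" "s \<le> t"
  shows "norm (fst (\<phi> t) - fst (\<phi> s)) \<le> norm (snd (\<phi> 0)) / \<mu> * (exp (- \<mu> * s) - exp (- \<mu> * t))"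
proof (cases "s = t")
  case False
  with s have st: "s < t" by simp
  let ?v = "norm (snd (\<phi> 0))"
  \<comment> \<open>An antiderivative of the velocity bound
    \<open>exp (- \<mu> * r) * ?v\<close>.\<close>
  let ?p = "\<lambda>r. - (?v / \<mu> * exp (- \<mu> * r))"
  have "norm (fst (\<phi> t) - fst (\<phi> s)) \<le> ?p t - ?p s"
  proof (rule differentiable_bound_general[where f = "\<lambda>r. fst (\<phi> r)" and f' = "\<lambda>r. snd (\<phi> r)"
        and \<phi>' = "\<lambda>r. exp (- \<mu> * r) * ?v", OF st])
    show "continuous_on {s..t} (\<lambda>r. fst (\<phi> r))"
      unfolding continuous_on_eq_continuous_within
    proof
      fix r assume "r \<in> {s..t}"
      with s have "0 \<le> r" "{s..t} \<subseteq> {0..}" by auto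
      then show "continuous (at r within {s..t}) (\<lambda>r. fst (\<phi> r))"
        using solution_on_kuramotoD(3)[OF \<phi>] has_vector_derivative_within_subset
          has_vector_derivative_continuous by blast
    qed
    show "continuous_on {s..t} ?p" by (intro continuous_intros)
    fix r assume r: "s < r" "r < t"
    have "at r within {0..} = at r" using r s by (intro at_within_interior) auto
    then show "((\<lambda>r. fst (\<phi> r)) has_vector_derivative snd (\<phi> r)) (at r)"
      using solution_on_kuramotoD(3)[OF \<phi>, of r] r s by simp
    show "(?p has_vector_derivative exp (- \<mu> * r) * ?v) (at r)"
      unfolding has_real_derivative_iff_has_vector_derivative[symmetric]
      using \<mu> by (auto intro!: derivative_eq_intros)
    show "norm (snd (\<phi> r)) \<le> exp (- \<mu> * r) * ?v"
      using r s by (intro kuramoto_velocity_decay[OF \<phi> coercive stay]) auto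
  qed
  then show ?thesis by (simp add: right_diff_distrib)
qed simp

text \<open>Completeness yields a limit along the integers; letting the later time in the bound run
  through the integers then gives convergence over all real times.\<close>

lemma convergent_at_top_if_exp_cauchy:
  fixes X :: "real \<Rightarrow> 'a::banach"
  assumes \<mu>: "\<mu> > 0"
    and bound: "\<And>s t. 0 \<le> s \<Longrightarrow> s \<le> t \<Longrightarrow> norm (X t - X s) \<le> c * exp (- \<mu> * s)"
  obtains l where "(X \<longlongrightarrow> l) at_top"
proof -
  have e0: "((\<lambda>t. c * exp (- \<mu> * t)) \<longlongrightarrow> 0) at_top"
    using \<mu>
    by (intro tendsto_mult_right_zero filterlim_compose[OF exp_at_bot]
        filterlim_tendsto_neg_mult_at_bot[OF tendsto_const _ filterlim_ident]) auto
  have "Cauchy (\<lambda>n. X (real n))"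
  proof (rule metric_CauchyI)
    fix e :: real assume "e > 0"
    then have "eventually (\<lambda>t. c * exp (- \<mu> * t) < e / 2) at_top"
      using order_tendstoD(2)[OF e0, of "e/2"] by simp
    then obtain t0 where t0: "\<And>t. t \<ge> t0 \<Longrightarrow> c * exp (- \<mu> * t) < e / 2"
      by (auto simp: eventually_at_top_linorder)
    obtain M :: nat where M: "real M \<ge> t0" using real_arch_simple by blast
    have *: "norm (X (real n) - X (real M)) < e / 2" if "n \<ge> M" for n
      using bound[of "real M" "real n"] t0[OF M] that by simp
    show "\<exists>M. \<forall>m\<ge>M. \<forall>n\<ge>M. dist (X (real m)) (X (real n)) < e"
    proof (intro exI allI impI)
      fix m n assume "m \<ge> M" "n \<ge> M"
      then show "dist (X (real m)) (X (real n)) < e"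
        using *[of m] *[of n] dist_triangle_half_l[of "X (real m)" "X (real M)" e "X (real n)"]
        by (simp add: dist_norm)
    qed
  qed
  then obtain l where l: "(\<lambda>n. X (real n)) \<longlonglongrightarrow> l"
    by (auto simp: Cauchy_convergent_iff convergent_def)
  have lim: "norm (X s - l) \<le> c * exp (- \<mu> * s)" if "0 \<le> s" for s
  proof (rule Lim_norm_ubound[OF trivial_limit_sequentially tendsto_diff[OF tendsto_const l]])
    have "norm (X s - X (real n)) \<le> c * exp (- \<mu> * s)" if "n \<ge> nat \<lceil>s\<rceil>" for n
      using bound[OF \<open>0 \<le> s\<close>, of "real n"] that by (simp add: norm_minus_commute nat_ceiling_le_eq)
    then show "\<forall>\<^sub>F n in sequentially. norm (X s - X (real n)) \<le> c * exp (- \<mu> * s)"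
      unfolding eventually_sequentially by blast
  qed
  have "((\<lambda>s. X s - l) \<longlongrightarrow> 0) at_top"
    by (rule Lim_null_comparison[OF eventually_mono[OF eventually_ge_at_top[of 0]] e0]) (rule lim)
  then show thesis using that by (simp add: LIM_zero_iff)
qed

subsection \<open>Trapping and semistability\<close>

text \<open>A first-exit argument: until the first exit from the ball of radius
  \<open>\<delta>\<close> coercivity holds, so the phase has moved by at most
  \<open>norm (snd (\<phi> 0)) / \<mu>\<close>, which is too little to reach the boundary.\<close>

lemma kuramoto_trapped:
  assumes \<phi>: "solution_on (kuramoto_field ep Kt) (kuramoto_states ep) \<phi>"
    and \<mu>: "\<mu> > 0"
    and coercive: "\<And>X V. X \<in> cball X0 r \<Longrightarrow> V \<in> range (edge_diff ep) \<Longrightarrow>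
       V \<bullet> coupling ep Kt (\<chi> k. cos (X $ k) * V $ k) \<ge> \<mu> * (norm V)\<^sup>2"
    and init: "norm (fst (\<phi> 0) - X0) + norm (snd (\<phi> 0)) / \<mu> < \<delta>" and \<delta>: "\<delta> \<le> r"
    and t: "0 \<le> t"
  shows "norm (fst (\<phi> t) - X0) < \<delta>"
proof (rule ccontr)
  assume "\<not> norm (fst (\<phi> t) - X0) < \<delta>"
  \<comment> \<open>The exit times. This set is closed, bounded below and, by the assumption for
    contradiction, nonempty, so its infimum is attained.\<close>
  let ?T = "{s \<in> {0..}. fst (\<phi> s) - X0 \<in> - ball 0 \<delta>}"
  have cont: "continuous_on {0..} (\<lambda>s. fst (\<phi> s))"
    using solution_on_kuramotoD(3)[OF \<phi>]
    by (auto simp: continuous_on_eq_continuous_within intro: has_vector_derivative_continuous)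
  have "closed ({0..} \<inter> (\<lambda>s. fst (\<phi> s) - X0) -` (- ball 0 \<delta>))"
    by (rule continuous_closed_preimage) (auto intro!: continuous_on_diff cont)
  then have "closed ?T" by (simp add: vimage_def Int_def)
  moreover have "t \<in> ?T" using \<open>\<not> _\<close> t by auto
  moreover have bdd: "bdd_below ?T" by (rule bdd_belowI[of _ 0]) auto
  ultimately have "Inf ?T \<in> ?T" by (intro closed_contains_Inf) auto
  then obtain b where b: "b = Inf ?T" "0 \<le> b" "norm (fst (\<phi> b) - X0) \<ge> \<delta>" by auto
  have stay: "fst (\<phi> s) \<in> cball X0 r" if "0 \<le> s" "s < b" for s
  proof -
    have "s \<notin> ?T" using cInf_lower[OF _ bdd, of s] that b(1) by auto
    then show ?thesis using that \<delta> by (auto simp: dist_norm norm_minus_commute)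
  qed
  have "norm (fst (\<phi> b) - fst (\<phi> 0)) \<le> norm (snd (\<phi> 0)) / \<mu> * (exp (- \<mu> * 0) - exp (- \<mu> * b))"
    by (rule kuramoto_displacement_bound[OF \<phi> \<mu> coercive stay]) (use b in auto)
  also have "\<dots> \<le> norm (snd (\<phi> 0)) / \<mu> * 1"
    using \<mu> by (intro mult_left_mono) auto
  finally have "norm (fst (\<phi> b) - X0) < \<delta>"
    using init norm_triangle_ineq[of "fst (\<phi> b) - fst (\<phi> 0)" "fst (\<phi> 0) - X0"] by simp
  then show False using b by simp
qed

lemma open_phase_box: "open (phase_box :: (real^'e) set)"
proof -
  have "(phase_box :: (real^'e) set) = (\<Inter>k. {X. - (pi / 2) < X $ k} \<inter> {X. X $ k < pi / 2})"
    by (auto simp: phase_box_def)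
  then show ?thesis
    by (elim ssubst) (intro open_INT open_Int open_Collect_less continuous_intros ballI finite)
qed

text \<open>Here \<open>r\<close> and \<open>\<mu>\<close> depend on \<open>X0\<close> but not on
  the starting point. The freedom to shrink \<open>\<delta>\<close> gives Lyapunov stability; the
  last conclusion gives convergence.\<close>

lemma kuramoto_trapped_flow:
  fixes ep :: "'e::{finite,linorder} \<Rightarrow> 'n::{finite,linorder} \<times> 'n"
  assumes "lex_edge_listing ep" "\<forall>k. Kt $ k \<ge> 0" "network_connected ep Kt"
    and X0: "X0 \<in> phase_box"
  obtains r \<mu> where "r > 0" "\<mu> > 0" "cball X0 r \<subseteq> phase_box"
    "\<And>z \<delta> t. z \<in> kuramoto_states ep \<Longrightarrow> norm (fst z - X0) + norm (snd z) / \<mu> < \<delta> \<Longrightarrow> \<delta> \<le> r \<Longrightarrow> 0 \<le> t \<Longrightarrow>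
       norm (fst (flow (kuramoto_field ep Kt) (kuramoto_states ep) t z) - X0) < \<delta> \<and>
       norm (snd (flow (kuramoto_field ep Kt) (kuramoto_states ep) t z)) \<le> norm (snd z)"
    "\<And>z. z \<in> kuramoto_states ep \<Longrightarrow> norm (fst z - X0) + norm (snd z) / \<mu> < r \<Longrightarrow>
       \<exists>X \<in> phase_box \<inter> range (edge_diff ep).
         ((\<lambda>t. flow (kuramoto_field ep Kt) (kuramoto_states ep) t z) \<longlongrightarrow> (X, 0)) at_top"
proof -
  let ?F = "kuramoto_field ep Kt" and ?S = "kuramoto_states ep"
  obtain r where r: "r > 0" "cball X0 r \<subseteq> phase_box"
    using X0 open_phase_box open_contains_cball by blast
  obtain \<mu> where \<mu>: "\<mu> > 0"
    and coercive: "\<And>X V. X \<in> cball X0 r \<Longrightarrow> V \<in> range (edge_diff ep) \<Longrightarrow>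
       V \<bullet> coupling ep Kt (\<chi> k. cos (X $ k) * V $ k) \<ge> \<mu> * (norm V)\<^sup>2"
    using coupling_coercive[OF assms(1-3) compact_cball r(2)] by metis
  show thesis
  proof
    show "r > 0" "\<mu> > 0" "cball X0 r \<subseteq> phase_box" by fact+
  next
    fix z \<delta> and t :: real
    assume z: "z \<in> ?S" and init: "norm (fst z - X0) + norm (snd z) / \<mu> < \<delta>"
      and \<delta>: "\<delta> \<le> r" and t: "0 \<le> t"
    obtain \<phi> where \<phi>: "solution_on ?F ?S \<phi>" "\<phi> 0 = z" using kuramoto_solution_exists[OF z] by metis
    have trap: "norm (fst (\<phi> s) - X0) < \<delta>" if "0 \<le> s" for s
      by (rule kuramoto_trapped[OF \<phi>(1) \<mu> coercive _ \<delta> that]) (use init \<phi>(2) in auto)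
    have "norm (snd (\<phi> t)) \<le> exp (- \<mu> * t) * norm (snd (\<phi> 0))"
    proof (rule kuramoto_velocity_decay[OF \<phi>(1) coercive _ t])
      show "fst (\<phi> s) \<in> cball X0 r" if "0 \<le> s" for s
        using trap[OF that] \<delta> by (simp add: dist_norm norm_minus_commute)
    qed
    also have "\<dots> \<le> 1 * norm (snd z)"
      using \<mu> t \<phi>(2) by (intro mult_mono) auto
    finally show "norm (fst (flow ?F ?S t z) - X0) < \<delta> \<and> norm (snd (flow ?F ?S t z)) \<le> norm (snd z)"
      using flow_kuramoto_eq[OF \<phi>(1) t] \<phi>(2) trap[OF t] by simp
  next
    fix z assume z: "z \<in> ?S" and init: "norm (fst z - X0) + norm (snd z) / \<mu> < r"
    obtain \<phi> where \<phi>: "solution_on ?F ?S \<phi>" "\<phi> 0 = z" using kuramoto_solution_exists[OF z] by metis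
    have ball: "fst (\<phi> s) \<in> cball X0 r" if "0 \<le> s" for s
    proof -
      have "norm (fst (\<phi> s) - X0) < r"
        by (rule kuramoto_trapped[OF \<phi>(1) \<mu> coercive _ order_refl that]) (use init \<phi>(2) in auto)
      then show ?thesis by (simp add: dist_norm norm_minus_commute)
    qed
    have ge0: "eventually (\<lambda>t. t \<ge> (0::real)) at_top" by (rule eventually_ge_at_top)
    have "norm (fst (\<phi> t) - fst (\<phi> s)) \<le> norm (snd (\<phi> 0)) / \<mu> * exp (- \<mu> * s)"
      if "0 \<le> s" "s \<le> t" for s t
    proof -
      have "norm (fst (\<phi> t) - fst (\<phi> s)) \<le> norm (snd (\<phi> 0)) / \<mu> * (exp (- \<mu> * s) - exp (- \<mu> * t))"
        by (rule kuramoto_displacement_bound[OF \<phi>(1) \<mu> coercive ball that])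
      also have "\<dots> \<le> norm (snd (\<phi> 0)) / \<mu> * exp (- \<mu> * s)"
        using \<mu> by (intro mult_left_mono) auto
      finally show ?thesis .
    qed
    then obtain X where X: "((\<lambda>t. fst (\<phi> t)) \<longlongrightarrow> X) at_top"
      using convergent_at_top_if_exp_cauchy[OF \<mu>, of "\<lambda>t. fst (\<phi> t)" "norm (snd (\<phi> 0)) / \<mu>"] by blast
    have V: "((\<lambda>t. snd (\<phi> t)) \<longlongrightarrow> 0) at_top"
    proof (rule Lim_null_comparison[OF eventually_mono[OF ge0]])
      show "norm (snd (\<phi> t)) \<le> exp (- \<mu> * t) * norm (snd (\<phi> 0))" if "0 \<le> t" for t
        by (rule kuramoto_velocity_decay[OF \<phi>(1) coercive ball that])
      show "((\<lambda>t. exp (- \<mu> * t) * norm (snd (\<phi> 0))) \<longlongrightarrow> 0) at_top"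
        using \<mu> by (intro tendsto_mult_left_zero filterlim_compose[OF exp_at_bot]
          filterlim_tendsto_neg_mult_at_bot[OF tendsto_const _ filterlim_ident]) auto
    qed
    \<comment> \<open>The closed ball lies inside the open box, so the limit cannot sit on the
      boundary of the box.\<close>
    have "X \<in> cball X0 r"
      by (rule Lim_in_closed_set[OF closed_cball eventually_mono[OF ge0 ball] _ X]) auto
    moreover have "X \<in> range (edge_diff ep)"
      by (rule Lim_in_closed_set[OF closed_subspace[OF subspace_range_edge_diff]
            eventually_mono[OF ge0 solution_on_kuramotoD(1)[OF \<phi>(1)]] _ X]) auto
    moreover have "((\<lambda>t. flow ?F ?S t z) \<longlongrightarrow> (X, 0)) at_top"
    proof (rule Lim_transform_eventually[OF _ eventually_mono[OF ge0]])
      show "((\<lambda>t. (fst (\<phi> t), snd (\<phi> t))) \<longlongrightarrow> (X, 0)) at_top"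
        by (intro tendsto_Pair X V)
      show "(fst (\<phi> t), snd (\<phi> t)) = flow ?F ?S t z" if "0 \<le> t" for t
        using flow_kuramoto_eq[OF \<phi>(1) that] \<phi>(2) by simp
    qed
    ultimately show "\<exists>X \<in> phase_box \<inter> range (edge_diff ep). ((\<lambda>t. flow ?F ?S t z) \<longlongrightarrow> (X, 0)) at_top"
      using r(2) by blast
  qed
qed

section \<open>The equilibria as members of \<open>kuramoto_H\<close>, and their stability\<close>

lemma incidence_gram_diag:
  assumes "lex_edge_listing ep"
  shows "(transpose (incidence_matrix ep) ** incidence_matrix ep) $ i $ i = 2"
proof -
  have ne: "fst (ep i) \<noteq> snd (ep i)" by (rule lex_edge_listing_ne[OF assms])
  have "(transpose (incidence_matrix ep) ** incidence_matrix ep) $ i $ i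
      = (\<Sum>a\<in>UNIV. (if a = fst (ep i) then 1 else 0) + (if a = snd (ep i) then 1 else 0))"
    unfolding matrix_matrix_mult_def transpose_def incidence_matrix_def
    using ne by (auto intro!: sum.cong)
  then show ?thesis by (simp add: sum.distrib)
qed

text \<open>The witness \<open>B K sin X\<close> for the frequencies makes the velocity vanish. The
  frequency bound is then the triangle inequality for a row of \<open>B\<^sup>T B K sin X\<close>:
  the diagonal entry 2 yields the term \<open>2 / N\<close> times the gain, after bounding its sine
  by 1.\<close>

lemma sync_equilibrium_in_kuramoto_H:
  fixes ep :: "'e::{finite,linorder} \<Rightarrow> 'n::{finite,linorder} \<times> 'n"
  assumes "lex_edge_listing ep" and K: "\<forall>k. Kt $ k \<ge> 0"
    and X: "X \<in> phase_box \<inter> range (edge_diff ep)"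
  shows "(X, 0) \<in> kuramoto_H ep Kt"
proof -
  let ?B = "incidence_matrix ep"
  let ?M = "transpose ?B ** ?B"
  let ?w = "gain_matrix ep Kt *v sin_vec X"
  let ?\<omega> = "?B *v ?w"
  \<comment> \<open>In the phase box the sine of an absolute value is nonnegative, so absolute
    values pass through the sine.\<close>
  have sin_abs: "\<bar>sin (X $ j)\<bar> = sin \<bar>X $ j\<bar>" for j
  proof -
    have "\<bar>X $ j\<bar> \<le> pi" using X by (auto simp: phase_box_def abs_le_iff) (smt (verit) pi_gt_zero field_sum_of_halves)+
    then have "sin \<bar>X $ j\<bar> \<ge> 0" by (intro sin_ge_zero) auto
    then show ?thesis by (auto simp: abs_if split: if_splits)
  qed
  have 1: "transpose ?B *v ?\<omega> = coupling ep Kt (sin_vec X)"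
    by (simp add: coupling_eq edge_diff_def del: transpose_matrix_vector)
  have "\<bar>axis i 1 \<bullet> (transpose ?B *v ?\<omega>)\<bar> \<le> 2 / real CARD('n) * Kt $ i
      + 1 / real CARD('n) * (\<Sum>j\<in>UNIV - {i}. \<bar>?M $ i $ j\<bar> * Kt $ j * sin \<bar>X $ j\<bar>)" for i
  proof -
    have "axis i 1 \<bullet> (transpose ?B *v ?\<omega>) = (?M *v ?w) $ i"
      by (simp only: inner_axis' matrix_vector_mul_assoc matrix_mul_assoc) simp
    also have "\<dots> = (\<Sum>j\<in>UNIV. ?M $ i $ j * ?w $ j)"
      by (simp add: matrix_vector_mult_def)
    also have "\<bar>\<dots>\<bar> \<le> (\<Sum>j\<in>UNIV. \<bar>?M $ i $ j * ?w $ j\<bar>)" by (rule sum_abs)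
    also have "\<dots> = (\<Sum>j\<in>UNIV. 1 / real CARD('n) * (\<bar>?M $ i $ j\<bar> * Kt $ j * sin \<bar>X $ j\<bar>))"
      using K by (intro sum.cong refl) (simp add: gain_matrix_mult sin_vec_def abs_mult sin_abs)
    also have "\<dots> = 1 / real CARD('n) * (\<Sum>j\<in>UNIV. \<bar>?M $ i $ j\<bar> * Kt $ j * sin \<bar>X $ j\<bar>)"
      by (rule sum_distrib_left[symmetric])
    also have "(\<Sum>j\<in>UNIV. \<bar>?M $ i $ j\<bar> * Kt $ j * sin \<bar>X $ j\<bar>)
        = 2 * Kt $ i * sin \<bar>X $ i\<bar> + (\<Sum>j\<in>UNIV - {i}. \<bar>?M $ i $ j\<bar> * Kt $ j * sin \<bar>X $ j\<bar>)"
      by (subst sum.remove[of UNIV i]) (auto simp: incidence_gram_diag[OF assms(1)])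
    also have "1 / real CARD('n) * \<dots> \<le> 1 / real CARD('n) * (2 * Kt $ i * 1
        + (\<Sum>j\<in>UNIV - {i}. \<bar>?M $ i $ j\<bar> * Kt $ j * sin \<bar>X $ j\<bar>))"
      using K by (intro mult_left_mono add_mono order_refl sin_le_one) auto
    finally show ?thesis by (simp add: distrib_left)
  qed
  moreover have "0 = transpose ?B *v ?\<omega> - (?M ** gain_matrix ep Kt) *v sin_vec X"
    unfolding 1 by (simp add: coupling_def)
  ultimately show ?thesis
    using X unfolding kuramoto_H_def col_space_edge_diff by blast
qed

lemma kuramoto_H_subset_states: "kuramoto_H ep Kt \<subseteq> kuramoto_states ep"
proof
  fix z assume "z \<in> kuramoto_H ep Kt"
  then obtain X \<omega> where "z = (X, edge_diff ep \<omega> - coupling ep Kt (sin_vec X))" "X \<in> range (edge_diff ep)"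
    unfolding kuramoto_H_def col_space_edge_diff edge_diff_def coupling_def by blast
  then show "z \<in> kuramoto_states ep"
    unfolding kuramoto_states_eq
    by (simp add: subspace_diff[OF subspace_range_edge_diff] coupling_in_range)
qed

lemma open_init_region:
  fixes a :: "'a::real_normed_vector"
  shows "open {z :: 'a \<times> 'b::real_normed_vector. norm (fst z - a) + norm (snd z) / c < d}"
  unfolding divide_inverse by (intro open_Collect_less continuous_intros)

lemma sync_equilibrium_lyapunov_stable:
  fixes ep :: "'e::{finite,linorder} \<Rightarrow> 'n::{finite,linorder} \<times> 'n"
  assumes net: "lex_edge_listing ep" "\<forall>k. Kt $ k \<ge> 0" "network_connected ep Kt"
    and X: "X \<in> phase_box \<inter> range (edge_diff ep)"
  shows "lyapunov_stable_equilibrium (kuramoto_field ep Kt) (kuramoto_states ep) (kuramoto_H ep Kt) (X, 0)"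
  unfolding lyapunov_stable_equilibrium_def
proof (intro conjI allI impI)
  let ?F = "kuramoto_field ep Kt" and ?S = "kuramoto_states ep"
  have "(X, 0) \<in> ?S"
    using X subspace_0[OF subspace_range_edge_diff] by (simp add: kuramoto_states_eq)
  then show "equilibrium ?F ?S (X, 0)"
    by (simp add: equilibrium_def kuramoto_field_def zero_prod_def)
  show "(X, 0) \<in> kuramoto_H ep Kt"
    by (rule sync_equilibrium_in_kuramoto_H[OF net(1,2) X])
  fix U :: "((real^('e::{finite,linorder})) \<times> (real^('e::{finite,linorder}))) set" assume "open U \<and> (X, 0) \<in> U"
  then obtain e where e: "e > 0" "ball (X, 0) e \<subseteq> U" using open_contains_ball by blast
  obtain r \<mu> where r: "r > 0" "\<mu> > 0"
    and trap: "\<And>z \<delta> t. z \<in> ?S \<Longrightarrow> norm (fst z - X) + norm (snd z) / \<mu> < \<delta> \<Longrightarrow> \<delta> \<le> r \<Longrightarrow> 0 \<le> t \<Longrightarrow>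
       norm (fst (flow ?F ?S t z) - X) < \<delta> \<and> norm (snd (flow ?F ?S t z)) \<le> norm (snd z)"
    using kuramoto_trapped_flow[OF net, of X] X by (metis IntD1)
  \<comment> \<open>The bound by \<open>r\<close> admits the trapping estimate; \<open>e / 2\<close>
    is the share of the phase, and the other half goes to the velocity, whose norm never exceeds its
    initial value.\<close>
  define \<delta> where "\<delta> = min r (e / 2)"
  let ?U' = "{z. norm (fst z - X) + norm (snd z) / \<mu> < \<delta>} \<inter> {z. norm (snd z) < e / 2}"
  have "open ?U'"
    by (intro open_Int open_init_region open_Collect_less continuous_intros)
  moreover have "(X, 0) \<in> ?U'" using r e by (simp add: \<delta>_def)
  moreover have "flow ?F ?S t z \<in> U" if z: "z \<in> ?U' \<inter> kuramoto_H ep Kt" and t: "0 \<le> t" for z t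
  proof -
    have "norm (fst (flow ?F ?S t z) - X) < \<delta> \<and> norm (snd (flow ?F ?S t z)) \<le> norm (snd z)"
      using z t kuramoto_H_subset_states by (intro trap) (auto simp: \<delta>_def)
    then have "norm (fst (flow ?F ?S t z) - X, snd (flow ?F ?S t z)) < e"
      using z norm_Pair_le[of "fst (flow ?F ?S t z) - X" "snd (flow ?F ?S t z)"]
      by (auto simp: \<delta>_def)
    moreover have "(fst (flow ?F ?S t z) - X, snd (flow ?F ?S t z)) = flow ?F ?S t z - (X, 0)"
      by (simp add: prod_eq_iff)
    ultimately have "dist (X, 0) (flow ?F ?S t z) < e"
      by (simp add: dist_norm norm_minus_commute)
    then show ?thesis using e(2) by auto
  qed
  ultimately show "\<exists>U'. open U' \<and> (X, 0) \<in> U' \<and> (\<forall>z\<in>U' \<inter> kuramoto_H ep Kt. \<forall>t\<ge>0. flow ?F ?S t z \<in> U)"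
    by blast
qed

theorem mainTheorem7:
  fixes ep :: "'e::{finite,linorder} \<Rightarrow> 'n::{finite,linorder} \<times> 'n"
    and Kt :: "real^('e::{finite,linorder})"
  assumes "CARD('n) \<ge> 2"
    and "lex_edge_listing ep"
    and "\<forall>k. Kt $ k \<ge> 0"
    and "network_connected ep Kt"
  shows "\<forall>x \<in> sync_equilibria ep.
           equilibrium (kuramoto_field ep Kt) (kuramoto_states ep) x \<longrightarrow>
           semistable_equilibrium (kuramoto_field ep Kt) (kuramoto_states ep)
             (kuramoto_H ep Kt) x"
proof (intro ballI impI)
  fix x assume "x \<in> sync_equilibria ep" and eq: "equilibrium (kuramoto_field ep Kt) (kuramoto_states ep) x"
  let ?F = "kuramoto_field ep Kt" and ?S = "kuramoto_states ep" and ?H = "kuramoto_H ep Kt"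
  obtain X where x: "x = (X, 0)" and X: "X \<in> phase_box \<inter> range (edge_diff ep)"
    using \<open>x \<in> sync_equilibria ep\<close> unfolding sync_equilibria_def col_space_edge_diff by blast
  obtain r \<mu> where r: "r > 0"
    and lim: "\<And>z. z \<in> ?S \<Longrightarrow> norm (fst z - X) + norm (snd z) / \<mu> < r \<Longrightarrow>
       \<exists>Y \<in> phase_box \<inter> range (edge_diff ep). ((\<lambda>t. flow ?F ?S t z) \<longlongrightarrow> (Y, 0)) at_top"
    using kuramoto_trapped_flow[OF assms(2-4), of X] X by (metis IntD1)
  let ?U = "?H \<inter> {z. norm (fst z - X) + norm (snd z) / \<mu> < r}"
  have xH: "x \<in> ?H"
    unfolding x by (rule sync_equilibrium_in_kuramoto_H[OF assms(2,3) X])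
  have "openin (top_of_set ?H) ?U" by (intro openin_open_Int open_init_region)
  moreover have "x \<in> ?U" using xH r by (simp add: x)
  moreover have "\<exists>l. ((\<lambda>t. flow ?F ?S t z) \<longlongrightarrow> l) at_top \<and> lyapunov_stable_equilibrium ?F ?S ?H l"
    if "z \<in> ?U" for z
  proof -
    have "z \<in> ?S" "norm (fst z - X) + norm (snd z) / \<mu> < r"
      using that kuramoto_H_subset_states by auto
    \<comment> \<open>The limit has zero velocity and a phase in the box, so it is again one of the
      equilibria covered by the stability lemma.\<close>
    from lim[OF this] show ?thesis
      using sync_equilibrium_lyapunov_stable[OF assms(2-4)] by blast
  qed
  ultimately show "semistable_equilibrium ?F ?S ?H x"
    unfolding semistable_equilibrium_def using eq xH by blast
qed

end
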